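(* Let $R\subset\mathbb{R}^N$ be a (normalized) root system with reflection group $G$ and positive subsystem $R_+$, let $k\ge0$ be a non-negative multiplicity function on $R$, let $E_k$ be the associated Dunkl kernel, and let $v=(v_g)_{g\in G}$ be the vector of asymptotic constants of $E_k$. For all $x,y\in C$ and $g\in G$, $$\lim_{t\to\infty}t^\gamma e^{-it\langle x,gy\rangle}E_k(itx,gy)=\frac{v_g}{\sqrt{w_k(x)w_k(y)}},$$ the convergence being locally uniform with respect to the parameter $x$.
   Context: A root system is a finite set $R\subset\mathbb{R}^N\setminus\{0\}$ with $R\cap\mathbb{R}\alpha=\{\pm\alpha\}$ and $\sigma_\alpha(R)=R$ for all $\alpha\in R$, where $\sigma_\alpha$ is the reflection in the hyperplane orthogonal to $\alpha$; it is normalized so that $\langle\alpha,\alpha\rangle=2$ for all $\alpha\in R$. $\langle\cdot,\cdot\rangle$ denotes the standard Euclidean scalar product and also its bilinear extension to $\mathbb{C}^N\times\mathbb{C}^N$. $G$ is the (finite) group generated by $\{\sigma_\alpha:\alpha\in R\}$, and $R_+$ is a fixed positive subsystem ($R=R_+\cup(-R_+)$ disjointly, the two parts separated by a hyperplane through the origin). A multiplicity function is a $G$-invariant function $k:R\to\mathbb{C}$; $k\ge 0$ means $k(\alpha)\ge0$ for all $\alpha$. For $\xi\in\mathbb{R}^N$ the Dunkl operator is $$T_\xi f(x)=\partial_\xi f(x)+\sum_{\alpha\in R_+}k(\alpha)\langle\alpha,\xi\rangle\frac{f(x)-f(\sigma_\alpha x)}{\langle\alpha,x\rangle}.$$ The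 Dunkl kernel $E_k$ ($k\geq 0$) is the holomorphic function on $\mathbb{C}^N\times\mathbb{C}^N$ such that for each $y\in\mathbb{C}^N$, $f=E_k(\cdot,y)$ is the unique real-analytic solution on $\mathbb{R}^N$ of $T_\xi f=\langle\xi,y\rangle f$ for all $\xi\in\mathbb{R}^N$, $f(0)=1$. $w_k(x)=\prod_{\alpha\in R_+}|\langle\alpha,x\rangle|^{2k(\alpha)}$ and $\gamma=\sum_{\alpha\in R_+}k(\alpha)$. $C=\{x\in\mathbb{R}^N:\langle\alpha,x\rangle>0\ \text{for all }\alpha\in R_+\}$, and $C_\delta=\{x\in C:\langle\alpha,x\rangle>\delta|x|\ \text{for all }\alpha\in R_+\}$ for $\delta>0$. The vector $v=(v_g)_{g\in G}\in\mathbb{C}^{|G|}$ of asymptotic constants is the (existing, non-zero) vector such that for all $y\in C$, $g\in G$, $\delta>0$: $\lim_{|x|\to\infty,\,x\in C_\delta}\sqrt{w_k(x)w_k(y)}\,e^{-i\langle x,gy\rangle}E_k(ix,gy)=v_g$. *)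

theory Defs
  imports "HOL-Analysis.Analysis" "HOL-Algebra.Generated_Groups" "HOL-Algebra.Bij"
begin

section \<open>Root systems, reflection groups, multiplicity functions\<close>

definition refl_hyp :: "real ^ 'n \<Rightarrow> real ^ 'n \<Rightarrow> real ^ 'n" where
  "refl_hyp \<alpha> x = x - (2 * (\<alpha> \<bullet> x) / (\<alpha> \<bullet> \<alpha>)) *\<^sub>R \<alpha>"

definition root_system :: "(real ^ 'n) set \<Rightarrow> bool" where
  "root_system R \<longleftrightarrow> finite R \<and> 0 \<notin> R \<and>
     (\<forall>\<alpha>\<in>R. R \<inter> span {\<alpha>} = {\<alpha>, -\<alpha>} \<and> refl_hyp \<alpha> ` R = R)"

definition normalized :: "(real ^ 'n) set \<Rightarrow> bool" where
  "normalized R \<longleftrightarrow> (\<forall>\<alpha>\<in>R. \<alpha> \<bullet> \<alpha> = 2)"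

definition refl_group :: "(real ^ 'n) set \<Rightarrow> (real ^ 'n \<Rightarrow> real ^ 'n) set" where
  "refl_group R = generate (BijGroup UNIV) (refl_hyp ` R)"

definition positive_subsystem :: "(real ^ 'n) set \<Rightarrow> (real ^ 'n) set \<Rightarrow> bool" where
  "positive_subsystem R Rp \<longleftrightarrow> R = Rp \<union> uminus ` Rp \<and> Rp \<inter> uminus ` Rp = {} \<and>
     (\<exists>\<beta>. \<forall>\<alpha>\<in>Rp. \<beta> \<bullet> \<alpha> > 0)"

text \<open>Multiplicity functions are complex-valued in general; the non-negative ones are
  real-valued, and these are the only ones needed here.\<close>

definition nonneg_multiplicity :: "(real ^ 'n) set \<Rightarrow> (real ^ 'n \<Rightarrow> real) \<Rightarrow> bool" where
  "nonneg_multiplicity R k \<longleftrightarrow>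
     (\<forall>g\<in>refl_group R. \<forall>\<alpha>\<in>R. k (g \<alpha>) = k \<alpha>) \<and> (\<forall>\<alpha>\<in>R. k \<alpha> \<ge> 0)"

definition dunkl_gamma :: "(real ^ 'n) set \<Rightarrow> (real ^ 'n \<Rightarrow> real) \<Rightarrow> real" where
  "dunkl_gamma Rp k = (\<Sum>\<alpha>\<in>Rp. k \<alpha>)"

text \<open>Only used on the open chamber: on the walls, \<open>0 powr 0 = 0\<close> departs from the usual
  convention when \<open>k \<alpha> = 0\<close>.\<close>

definition dunkl_weight :: "(real ^ 'n) set \<Rightarrow> (real ^ 'n \<Rightarrow> real) \<Rightarrow> real ^ 'n \<Rightarrow> real" where
  "dunkl_weight Rp k x = (\<Prod>\<alpha>\<in>Rp. \<bar>\<alpha> \<bullet> x\<bar> powr (2 * k \<alpha>))"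

definition chamber :: "(real ^ 'n) set \<Rightarrow> (real ^ 'n) set" where
  "chamber Rp = {x. \<forall>\<alpha>\<in>Rp. \<alpha> \<bullet> x > 0}"

definition chamber_cone :: "(real ^ 'n) set \<Rightarrow> real \<Rightarrow> (real ^ 'n) set" where
  "chamber_cone Rp \<delta> = {x \<in> chamber Rp. \<forall>\<alpha>\<in>Rp. \<alpha> \<bullet> x > \<delta> * norm x}"


section \<open>The Dunkl kernel\<close>

definition cvec :: "real ^ 'n \<Rightarrow> complex ^ 'n" where
  "cvec x = (\<chi> i. of_real (x $ i))"

text \<open>The bilinear extension of the scalar product; \<open>\<bullet>\<close> on \<open>complex ^ 'n\<close> is the
  real part of the sesquilinear one.\<close>

definition cdot :: "complex ^ 'n \<Rightarrow> complex ^ 'n \<Rightarrow> complex" where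
  "cdot z w = (\<Sum>i\<in>UNIV. z $ i * w $ i)"

text \<open>For a root with \<open>\<alpha> \<bullet> \<alpha> = 2\<close> and smooth \<open>f\<close>, the quotient
  \<open>(f x - f (refl_hyp \<alpha> x)) / (\<alpha> \<bullet> x)\<close> extends continuously to the hyperplane
  \<open>\<alpha> \<bullet> x = 0\<close>, with value the derivative of \<open>f\<close> in direction \<open>\<alpha>\<close>: replacing \<open>x\<close> by
  \<open>x + s *\<^sub>R \<alpha>\<close> gives \<open>(f (x + s *\<^sub>R \<alpha>) - f (x - s *\<^sub>R \<alpha>)) / (2 * s)\<close>.\<close>

definition dunkl_quotient :: "real ^ 'n \<Rightarrow> (real ^ 'n \<Rightarrow> complex) \<Rightarrow> real ^ 'n \<Rightarrow> complex" where
  "dunkl_quotient \<alpha> f x =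
     (if \<alpha> \<bullet> x = 0 then frechet_derivative f (at x) \<alpha>
      else (f x - f (refl_hyp \<alpha> x)) / of_real (\<alpha> \<bullet> x))"

definition dunkl_op :: "(real ^ 'n) set \<Rightarrow> (real ^ 'n \<Rightarrow> real) \<Rightarrow> real ^ 'n \<Rightarrow>
    (real ^ 'n \<Rightarrow> complex) \<Rightarrow> real ^ 'n \<Rightarrow> complex" where
  "dunkl_op Rp k \<xi> f x = frechet_derivative f (at x) \<xi> +
     (\<Sum>\<alpha>\<in>Rp. of_real (k \<alpha> * (\<alpha> \<bullet> \<xi>)) * dunkl_quotient \<alpha> f x)"

text \<open>Local expansion into a convergent power series, with multi-indices \<open>m :: 'n \<Rightarrow> nat\<close>.\<close>

definition real_analytic :: "(real ^ 'n \<Rightarrow> complex) \<Rightarrow> bool" where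
  "real_analytic f \<longleftrightarrow> (\<forall>a. \<exists>r>0. \<exists>c :: ('n \<Rightarrow> nat) \<Rightarrow> complex. \<forall>x\<in>ball a r.
     ((\<lambda>m. c m * of_real (\<Prod>i\<in>UNIV. (x $ i - a $ i) ^ m i)) has_sum f x) UNIV)"

text \<open>Holomorphy on \<open>\<complex>\<^sup>N \<times> \<complex>\<^sup>N\<close>: complex differentiability at every point, that is,
  existence of a complex-linear Frechet derivative.\<close>

definition holomorphic2 :: "(complex ^ 'n \<Rightarrow> complex ^ 'n \<Rightarrow> complex) \<Rightarrow> bool" where
  "holomorphic2 E \<longleftrightarrow> (\<forall>z w. \<exists>L. ((\<lambda>(z', w'). E z' w') has_derivative L) (at (z, w)) \<and>
     (\<forall>c u u'. L (c *s u, c *s u') = c * L (u, u')))"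

definition dunkl_eigenfunction :: "(real ^ 'n) set \<Rightarrow> (real ^ 'n \<Rightarrow> real) \<Rightarrow> complex ^ 'n \<Rightarrow>
    (real ^ 'n \<Rightarrow> complex) \<Rightarrow> bool" where
  "dunkl_eigenfunction Rp k y f \<longleftrightarrow> real_analytic f \<and>
     (\<forall>\<xi> x. dunkl_op Rp k \<xi> f x = cdot (cvec \<xi>) y * f x) \<and> f 0 = 1"

definition is_dunkl_kernel :: "(real ^ 'n) set \<Rightarrow> (real ^ 'n \<Rightarrow> real) \<Rightarrow>
    (complex ^ 'n \<Rightarrow> complex ^ 'n \<Rightarrow> complex) \<Rightarrow> bool" where
  "is_dunkl_kernel Rp k E \<longleftrightarrow> holomorphic2 E \<and>
     (\<forall>y. dunkl_eigenfunction Rp k y (\<lambda>x. E (cvec x) y) \<and>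
       (\<forall>f. dunkl_eigenfunction Rp k y f \<longrightarrow> f = (\<lambda>x. E (cvec x) y)))"


section \<open>The asymptotic constants\<close>

text \<open>The values of \<open>v\<close> outside \<open>refl_group R\<close> are irrelevant. For large \<open>\<delta>\<close> the cone
  can be empty, and then the condition on the limit is void.\<close>

definition asymptotic_constants :: "(real ^ 'n) set \<Rightarrow> (real ^ 'n) set \<Rightarrow> (real ^ 'n \<Rightarrow> real) \<Rightarrow>
    (complex ^ 'n \<Rightarrow> complex ^ 'n \<Rightarrow> complex) \<Rightarrow> ((real ^ 'n \<Rightarrow> real ^ 'n) \<Rightarrow> complex) \<Rightarrow> bool" where
  "asymptotic_constants R Rp k E v \<longleftrightarrow>
     (\<forall>y\<in>chamber Rp. \<forall>g\<in>refl_group R. \<forall>\<delta>>0.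
       ((\<lambda>x. of_real (sqrt (dunkl_weight Rp k x * dunkl_weight Rp k y)) *
             exp (- \<i> * of_real (x \<bullet> g y)) * E (\<i> *s cvec x) (cvec (g y)))
         \<longlongrightarrow> v g) (inf at_infinity (principal (chamber_cone Rp \<delta>))))"

end

theory Submission
  imports Defs "HOL-Complex_Analysis.Conformal_Mappings"
begin

text \<open>The weight is homogeneous, \<open>w\<^sub>k(tx) = t\<^bsup>2\<gamma>\<^esup> w\<^sub>k(x)\<close> (\<open>dunkl_weight_scaleR\<close>), so the quantity
  \<open>t\<^sup>\<gamma> exp(-it\<langle>x,gy\<rangle>) E(itx, gy)\<close> is the function in the definition of the asymptotic constants,
  taken at the point \<open>tx\<close> and divided by \<open>sqrt (w\<^sub>k(x) w\<^sub>k(y))\<close>. When there are roots, every point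
  \<open>x\<^sub>0\<close> of the chamber is nonzero and lies in some cone \<open>C\<^sub>\<delta>\<close>. Then \<open>x\<^sub>0\<close> has the neighbourhood
  \<open>{x \<in> C\<^sub>\<delta>. |x| > \<eta>}\<close> with \<open>\<eta> = |x\<^sub>0|/2\<close>. On it \<open>|tx| > t\<eta>\<close> tends to infinity inside \<open>C\<^sub>\<delta>\<close>
  at a rate independent of \<open>x\<close>, and \<open>w\<^sub>k\<close> is bounded below by a positive constant, because
  every \<open>\<langle>\<alpha>,x\<rangle>\<close> exceeds \<open>\<delta>\<eta>\<close>. Hence the convergence is uniform there.

  The empty root system is exceptional: the chamber is then the whole space, and near its point
  \<open>0\<close> the points \<open>tx\<close> do not go to infinity uniformly. In this case \<open>E(x, w)\<close> is the exponential
  \<open>exp \<langle>x,w\<rangle>\<close> (\<open>dunkl_kernel_no_roots\<close>), so the quantity is constantly \<open>1\<close>, and \<open>v\<^sub>g = 1\<close>.\<close>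

lemma dunkl_weight_scaleR:
  assumes "t > 0"
  shows "dunkl_weight Rp k (t *\<^sub>R x) = t powr (2 * dunkl_gamma Rp k) * dunkl_weight Rp k x"
proof -
  have "dunkl_weight Rp k (t *\<^sub>R x) = (\<Prod>\<alpha>\<in>Rp. t powr (2 * k \<alpha>) * \<bar>\<alpha> \<bullet> x\<bar> powr (2 * k \<alpha>))"
    using assms by (simp add: dunkl_weight_def abs_mult powr_mult)
  also have "\<dots> = t powr (\<Sum>\<alpha>\<in>Rp. 2 * k \<alpha>) * dunkl_weight Rp k x"
    using assms by (simp add: prod.distrib dunkl_weight_def powr_sum)
  finally show ?thesis
    by (simp add: dunkl_gamma_def sum_distrib_left)
qed

lemma dunkl_weight_pos:
  assumes "x \<in> chamber Rp"
  shows "dunkl_weight Rp k x > 0"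
  unfolding dunkl_weight_def using assms by (intro prod_pos) (force simp: chamber_def)

lemma dunkl_weight_lower_bound:
  assumes "c > 0" and "\<And>\<alpha>. \<alpha> \<in> Rp \<Longrightarrow> k \<alpha> \<ge> 0" and "\<And>\<alpha>. \<alpha> \<in> Rp \<Longrightarrow> \<alpha> \<bullet> x \<ge> c"
  shows "dunkl_weight Rp k x \<ge> (\<Prod>\<alpha>\<in>Rp. c powr (2 * k \<alpha>))"
  unfolding dunkl_weight_def
proof (intro prod_mono conjI powr_mono2)
  fix \<alpha> assume "\<alpha> \<in> Rp"
  then show "0 \<le> 2 * k \<alpha>" and "c \<le> \<bar>\<alpha> \<bullet> x\<bar>"
    using assms(2,3)[of \<alpha>] by auto
qed (use assms(1) in auto)

lemma chamber_cone_scaleR: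
  assumes "t > 0" and "x \<in> chamber_cone Rp \<delta>"
  shows "t *\<^sub>R x \<in> chamber_cone Rp \<delta>"
proof -
  have "\<delta> * norm (t *\<^sub>R x) = t * (\<delta> * norm x)"
    using assms(1) by simp
  then show ?thesis
    using assms by (auto simp: chamber_cone_def chamber_def)
qed

lemma chamber_nonzero:
  assumes "Rp \<noteq> {}" and "x \<in> chamber Rp"
  shows "x \<noteq> 0"
  using assms by (auto simp: chamber_def)

lemma open_chamber_cone:
  assumes "finite Rp" and "\<delta> > 0"
  shows "open (chamber_cone Rp \<delta>)"
proof -
  have "chamber_cone Rp \<delta> = (\<Inter>\<alpha>\<in>Rp. {x. \<delta> * norm x < \<alpha> \<bullet> x})"
    using assms(2) order.strict_trans1[OF mult_nonneg_nonneg[of \<delta> "norm x" for x]]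
    by (fastforce simp: chamber_cone_def chamber_def)
  moreover have "open {x. \<delta> * norm x < \<alpha> \<bullet> x}" for \<alpha> :: "real ^ 'n"
    by (intro open_Collect_less continuous_intros)
  ultimately show ?thesis
    using assms(1) by auto
qed

lemma chamber_in_cone:
  assumes "finite Rp" and "x \<in> chamber Rp"
  obtains \<delta> where "\<delta> > 0" and "x \<in> chamber_cone Rp \<delta>"
proof -
  define m where "m = Min (insert 1 ((\<lambda>\<alpha>. \<alpha> \<bullet> x) ` Rp))"
  have m: "m > 0" "\<And>\<alpha>. \<alpha> \<in> Rp \<Longrightarrow> m \<le> \<alpha> \<bullet> x"
    using assms by (auto simp: m_def chamber_def)
  \<comment> \<open>The denominator exceeds \<open>norm x\<close>, which makes the inequality strict and covers \<open>x = 0\<close>.\<close>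
  have "m / (norm x + 1) * norm x < m"
    using m(1) norm_ge_zero[of x] by (simp add: pos_divide_less_eq add_nonneg_pos)
  then have "x \<in> chamber_cone Rp (m / (norm x + 1))"
    using m(2) assms(2) by (force simp: chamber_cone_def)
  moreover have "m / (norm x + 1) > 0"
    using m(1) by (simp add: add_nonneg_pos)
  ultimately show ?thesis
    using that by blast
qed

text \<open>Without roots the Dunkl operators are the partial derivatives. On each complex line
  through the origin they give the equation \<open>f' = \<mu>f\<close>, but only at real parameters. Since \<open>f\<close> is
  entire, the identity theorem extends the equation to all complex parameters, including the
  imaginary ones at which the asymptotics are taken.\<close>

lemma dunkl_kernel_no_roots:
  fixes E :: "complex ^ 'n \<Rightarrow> complex ^ 'n \<Rightarrow> complex"
  assumes "is_dunkl_kernel {} k E"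
  shows "E (z *s cvec x) w = exp (z * cdot (cvec x) w)"
proof -
  define \<mu> where "\<mu> = cdot (cvec x) w"
  define f where "f = (\<lambda>z. E (z *s cvec x) w)"
  have hol: "holomorphic2 E" and eig: "dunkl_eigenfunction {} k w (\<lambda>x. E (cvec x) w)"
    using assms by (auto simp: is_dunkl_kernel_def)
  have lin: "bounded_linear (\<lambda>h. h *s cvec x)"
    by (auto intro!: linear_conv_bounded_linear[THEN iffD1] linearI simp: vec_eq_iff algebra_simps)
  have blc: "bounded_linear (cvec :: real ^ 'n \<Rightarrow> complex ^ 'n)"
    by (auto intro!: linear_conv_bounded_linear[THEN iffD1] linearI simp: vec_eq_iff cvec_def
        scaleR_conv_of_real[where 'a = complex])
  have ex: "\<exists>L. ((\<lambda>p. E (fst p) (snd p)) has_derivative L) (at (z, w)) \<and>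
      (\<forall>c u u'. L (c *s u, c *s u') = c * L (u, u'))" for z
    using hol unfolding holomorphic2_def case_prod_unfold by blast
  have field: "(f has_field_derivative L (cvec x, 0)) (at z)"
    if L: "((\<lambda>p. E (fst p) (snd p)) has_derivative L) (at (z *s cvec x, w))"
      and clin: "\<forall>c u u'. L (c *s u, c *s u') = c * L (u, u')" for L z
  proof -
    have "((\<lambda>z. (z *s cvec x, w)) has_derivative (\<lambda>h. (h *s cvec x, 0))) (at z)"
      by (intro has_derivative_Pair has_derivative_const bounded_linear_imp_has_derivative lin)
    from has_derivative_compose[OF this L]
    have "(f has_derivative (\<lambda>h. L (h *s cvec x, 0))) (at z)"
      by (simp add: f_def)
    moreover have "L (h *s cvec x, 0) = L (cvec x, 0) * h" for h
      using clin[rule_format, of h "cvec x" 0] by (simp add: mult.commute)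
    ultimately show ?thesis
      by (simp add: has_field_derivative_def)
  qed
  have f_hol: "f holomorphic_on UNIV"
    using ex field by (auto simp: holomorphic_on_open) blast
  \<comment> \<open>The eigenvalue equation is known on \<open>\<real>\<^sup>N\<close> only; it is read off in the direction \<open>x\<close>.\<close>
  have real_pt: "deriv f (of_real t) = \<mu> * f (of_real t)" for t
  proof -
    have tx: "of_real t *s cvec x = cvec (t *\<^sub>R x)"
      by (simp add: vec_eq_iff cvec_def)
    obtain L where L: "((\<lambda>p. E (fst p) (snd p)) has_derivative L) (at (of_real t *s cvec x, w))"
      and clin: "\<forall>c u u'. L (c *s u, c *s u') = c * L (u, u')"
      using ex by blast
    have "((\<lambda>X. (cvec X, w)) has_derivative (\<lambda>h. (cvec h, 0))) (at (t *\<^sub>R x))"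
      by (intro has_derivative_Pair has_derivative_const bounded_linear_imp_has_derivative blc)
    from has_derivative_compose[OF this L[unfolded tx]]
    have "((\<lambda>X. E (cvec X) w) has_derivative (\<lambda>h. L (cvec h, 0))) (at (t *\<^sub>R x))"
      by simp
    then have "frechet_derivative (\<lambda>X. E (cvec X) w) (at (t *\<^sub>R x)) = (\<lambda>h. L (cvec h, 0))"
      using frechet_derivative_at by metis
    moreover have "dunkl_op {} k x (\<lambda>X. E (cvec X) w) (t *\<^sub>R x) = \<mu> * E (cvec (t *\<^sub>R x)) w"
      using eig by (simp add: dunkl_eigenfunction_def \<mu>_def)
    ultimately have "L (cvec x, 0) = \<mu> * f (of_real t)"
      by (simp add: dunkl_op_def f_def tx)
    then show ?thesis
      using DERIV_imp_deriv[OF field[OF L clin]] by simp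
  qed
  have "(0::complex) islimpt \<real>"
    unfolding islimpt_approachable
  proof (intro allI impI)
    fix e :: real assume "e > 0"
    then show "\<exists>x'\<in>\<real>. x' \<noteq> (0::complex) \<and> dist x' 0 < e"
      by (intro bexI[of _ "of_real (e / 2)"]) auto
  qed
  moreover have "(\<lambda>z. deriv f z - \<mu> * f z) holomorphic_on UNIV"
    using f_hol by (intro holomorphic_intros holomorphic_deriv) auto
  moreover have "deriv f z - \<mu> * f z = 0" if "z \<in> \<real>" for z
    using that real_pt by (metis Reals_cases right_minus_eq)
  ultimately have ode: "deriv f z - \<mu> * f z = 0" for z
    using analytic_continuation[of "\<lambda>z. deriv f z - \<mu> * f z" UNIV \<real> 0 z]
    by (metis UNIV_I connected_UNIV open_UNIV subset_UNIV)
  have "((\<lambda>z. f z * exp (- \<mu> * z)) has_field_derivative 0) (at z)" for z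
  proof -
    have "(f has_field_derivative \<mu> * f z) (at z)"
      using holomorphic_derivI[OF f_hol open_UNIV UNIV_I, of z UNIV] ode[of z] by simp
    then show ?thesis
      by (auto intro!: derivative_eq_intros)
  qed
  then obtain c where c: "\<And>z. f z * exp (- \<mu> * z) = c"
    using has_field_derivative_zero_constant[of UNIV "\<lambda>z. f z * exp (- \<mu> * z)"] by auto
  have "cvec 0 = (0 :: complex ^ 'n)"
    by (simp add: vec_eq_iff cvec_def)
  then have "f 0 = 1"
    using eig by (simp add: f_def dunkl_eigenfunction_def)
  then have "c = 1"
    using c[of 0] by simp
  then show ?thesis
    using c[of z] by (simp add: f_def \<mu>_def exp_minus field_simps)
qed

lemma cdot_cvec: "cdot (cvec x) (cvec y) = of_real (x \<bullet> y)"
  by (simp add: cdot_def cvec_def inner_vec_def)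

text \<open>The core of the argument, for an arbitrary function \<open>A\<close> with a limit along \<open>C\<^sub>\<delta>\<close>:
  on the part of the cone away from the origin, \<open>t *\<^sub>R x\<close> runs to infinity uniformly in \<open>x\<close>,
  and division by a function bounded away from zero preserves uniform convergence.\<close>

lemma uniform_limit_along_rays:
  fixes A :: "real ^ 'n \<Rightarrow> complex" and d :: "real ^ 'n \<Rightarrow> real"
  assumes lim: "(A \<longlongrightarrow> a) (inf at_infinity (principal (chamber_cone Rp \<delta>)))"
    and "\<eta> > 0" and "c > 0"
    and U: "\<And>x. x \<in> U \<Longrightarrow> x \<in> chamber_cone Rp \<delta> \<and> norm x > \<eta> \<and> d x \<ge> c"
  shows "uniform_limit U (\<lambda>t x. A (t *\<^sub>R x) / of_real (d x)) (\<lambda>x. a / of_real (d x)) at_top"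
proof (rule uniform_limitI)
  fix e :: real assume "e > 0"
  then have "eventually (\<lambda>x. dist (A x) a < e * c) (inf at_infinity (principal (chamber_cone Rp \<delta>)))"
    using lim \<open>c > 0\<close> by (intro tendstoD) auto
  then obtain B where B: "\<And>x. norm x \<ge> B \<Longrightarrow> x \<in> chamber_cone Rp \<delta> \<Longrightarrow> dist (A x) a < e * c"
    unfolding eventually_inf_principal eventually_at_infinity by blast
  show "\<forall>\<^sub>F t in at_top. \<forall>x\<in>U. dist (A (t *\<^sub>R x) / of_real (d x)) (a / of_real (d x)) < e"
    using eventually_gt_at_top[of 0] eventually_ge_at_top[of "B / \<eta>"]
  proof eventually_elim
    case (elim t)
    show ?case
    proof
      fix x assume x: "x \<in> U"
      have "B \<le> t * \<eta>"
        using elim \<open>\<eta> > 0\<close> by (simp add: field_simps)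
      also have "\<dots> \<le> norm (t *\<^sub>R x)"
        using elim U[OF x] by (simp add: mult_left_mono less_imp_le)
      finally have "dist (A (t *\<^sub>R x)) a < e * c"
        using B chamber_cone_scaleR[OF elim(1)] U[OF x] by blast
      also have "\<dots> \<le> e * d x"
        using U[OF x] \<open>e > 0\<close> by simp
      finally have "dist (A (t *\<^sub>R x)) a < e * d x" .
      moreover have "d x > 0"
        using U[OF x] \<open>c > 0\<close> by linarith
      ultimately show "dist (A (t *\<^sub>R x) / of_real (d x)) (a / of_real (d x)) < e"
        by (simp add: dist_norm norm_divide pos_divide_less_eq flip: diff_divide_distrib)
    qed
  qed
qed

theorem corollary5p3:
  fixes R Rp :: "(real ^ 'n) set"
    and k :: "real ^ 'n \<Rightarrow> real"
    and E :: "complex ^ 'n \<Rightarrow> complex ^ 'n \<Rightarrow> complex"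
    and v :: "(real ^ 'n \<Rightarrow> real ^ 'n) \<Rightarrow> complex"
  assumes "root_system R" and "normalized R"
    and "positive_subsystem R Rp"
    and "nonneg_multiplicity R k"
    and "is_dunkl_kernel Rp k E"
    and "asymptotic_constants R Rp k E v"
  defines "F \<equiv> \<lambda>g y t x. of_real (t powr dunkl_gamma Rp k) *
      exp (- \<i> * of_real t * of_real (x \<bullet> g y)) * E ((\<i> * of_real t) *s cvec x) (cvec (g y))"
    and "l \<equiv> \<lambda>g y x. v g / of_real (sqrt (dunkl_weight Rp k x * dunkl_weight Rp k y))"
  shows "\<forall>y\<in>chamber Rp. \<forall>g\<in>refl_group R.
      (\<forall>x\<in>chamber Rp. ((\<lambda>t::real. F g y t x) \<longlongrightarrow> l g y x) at_top) \<and>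
      (\<forall>x\<in>chamber Rp. \<exists>U. open U \<and> x \<in> U \<and> U \<subseteq> chamber Rp \<and>
         uniform_limit U (F g y) (l g y) at_top)"
proof (intro ballI)
  fix y g assume y: "y \<in> chamber Rp" and g: "g \<in> refl_group R"
  define A where "A = (\<lambda>x. of_real (sqrt (dunkl_weight Rp k x * dunkl_weight Rp k y)) *
             exp (- \<i> * of_real (x \<bullet> g y)) * E (\<i> *s cvec x) (cvec (g y)))"
  have A_lim: "(A \<longlongrightarrow> v g) (inf at_infinity (principal (chamber_cone Rp \<delta>)))" if "\<delta> > 0" for \<delta>
    using assms(6) y g that unfolding asymptotic_constants_def A_def by blast
  have Rp: "Rp \<subseteq> R" and fin: "finite Rp"
    using assms(1,3) by (auto simp: positive_subsystem_def root_system_def)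
  have k: "k \<alpha> \<ge> 0" if "\<alpha> \<in> Rp" for \<alpha>
    using assms(4) Rp that by (auto simp: nonneg_multiplicity_def)
  have "\<exists>U. open U \<and> x0 \<in> U \<and> U \<subseteq> chamber Rp \<and> uniform_limit U (F g y) (l g y) at_top"
    if x0: "x0 \<in> chamber Rp" for x0
  proof (cases "Rp = {}")
    case True
    have ker: "E (z *s cvec x) (cvec (g y)) = exp (z * of_real (x \<bullet> g y))" for z x
      using dunkl_kernel_no_roots assms(5) True cdot_cvec by metis
    have "A = (\<lambda>x. 1)"
      by (simp add: A_def ker True dunkl_weight_def fun_eq_iff flip: exp_add)
    moreover have "chamber_cone Rp 1 = UNIV"
      by (simp add: True chamber_cone_def chamber_def)
    ultimately have "((\<lambda>x :: real ^ 'n. 1) \<longlongrightarrow> v g) at_infinity"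
      using A_lim[of 1] by simp
    then have "v g = 1"
      using tendsto_unique[OF _ _ tendsto_const] trivial_limit_at_infinity by blast
    then have l: "l g y x = 1" for x
      by (simp add: l_def True dunkl_weight_def)
    have "F g y t x = 1" if "t > 0" for t x
      using that by (simp add: F_def ker True dunkl_gamma_def flip: exp_add)
    then have "uniform_limit UNIV (F g y) (l g y) at_top"
      by (intro uniform_limitI eventually_mono[OF eventually_gt_at_top[of 0]]) (auto simp: l)
    then show ?thesis
      using True by (intro exI[of _ UNIV]) (auto simp: chamber_def)
  next
    case False
    obtain \<delta> where \<delta>: "\<delta> > 0" "x0 \<in> chamber_cone Rp \<delta>"
      using chamber_in_cone[OF fin x0] by blast
    define \<eta> where "\<eta> = norm x0 / 2"
    have \<eta>: "\<eta> > 0" "norm x0 > \<eta>"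
      using chamber_nonzero[OF False x0] by (auto simp: \<eta>_def)
    define U where "U = chamber_cone Rp \<delta> \<inter> {x. norm x > \<eta>}"
    define d where "d = (\<lambda>x. sqrt (dunkl_weight Rp k x * dunkl_weight Rp k y))"
    define c where "c = sqrt ((\<Prod>\<alpha>\<in>Rp. (\<delta> * \<eta>) powr (2 * k \<alpha>)) * dunkl_weight Rp k y)"
    have U_chamber: "U \<subseteq> chamber Rp"
      by (auto simp: U_def chamber_cone_def)
    have "open U"
      unfolding U_def
      by (intro open_Int open_chamber_cone fin \<delta> open_Collect_less continuous_intros)
    have "c > 0"
      using \<delta> \<eta> dunkl_weight_pos[OF y] by (auto simp: c_def intro!: mult_pos_pos prod_pos)
    have "d x \<ge> c" if "x \<in> U" for x
    proof -
      have "\<alpha> \<bullet> x \<ge> \<delta> * \<eta>" if "\<alpha> \<in> Rp" for \<alpha>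
      proof -
        have "\<delta> * \<eta> \<le> \<delta> * norm x"
          using \<open>x \<in> U\<close> \<delta>(1) by (simp add: U_def)
        also have "\<dots> \<le> \<alpha> \<bullet> x"
          using \<open>x \<in> U\<close> that by (auto simp: U_def chamber_cone_def less_imp_le)
        finally show ?thesis .
      qed
      then have "dunkl_weight Rp k x \<ge> (\<Prod>\<alpha>\<in>Rp. (\<delta> * \<eta>) powr (2 * k \<alpha>))"
        using \<delta>(1) \<eta>(1) k by (intro dunkl_weight_lower_bound) auto
      then show ?thesis
        using dunkl_weight_pos[OF y, of k]
        by (auto simp: c_def d_def intro!: real_sqrt_le_mono mult_right_mono)
    qed
    then have "uniform_limit U (\<lambda>t x. A (t *\<^sub>R x) / of_real (d x)) (\<lambda>x. v g / of_real (d x)) at_top"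
      by (intro uniform_limit_along_rays[OF A_lim[OF \<delta>(1)] \<eta>(1) \<open>c > 0\<close>]) (auto simp: U_def)
    moreover have "A (t *\<^sub>R x) / of_real (d x) = F g y t x" if "t > 0" "x \<in> U" for t x
    proof -
      have "dunkl_weight Rp k x > 0"
        using dunkl_weight_pos U_chamber \<open>x \<in> U\<close> by blast
      then have d_pos: "d x > 0"
        using dunkl_weight_pos[OF y] by (simp add: d_def)
      have "sqrt (t powr (2 * dunkl_gamma Rp k)) = t powr dunkl_gamma Rp k"
        using \<open>t > 0\<close> by (simp add: powr_half_sqrt[symmetric] powr_powr)
      then have "sqrt (dunkl_weight Rp k (t *\<^sub>R x) * dunkl_weight Rp k y)
          = t powr dunkl_gamma Rp k * d x"
        using \<open>t > 0\<close> by (simp add: dunkl_weight_scaleR d_def real_sqrt_mult)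
      moreover have "\<i> *s cvec (t *\<^sub>R x) = (\<i> * of_real t) *s cvec x"
        by (simp add: vec_eq_iff cvec_def)
      ultimately show ?thesis
        using d_pos by (simp add: A_def F_def mult.assoc)
    qed
    then have "\<forall>\<^sub>F t in at_top. \<forall>x\<in>U. A (t *\<^sub>R x) / of_real (d x) = F g y t x"
      by (intro eventually_mono[OF eventually_gt_at_top[of 0]]) blast
    ultimately have "uniform_limit U (F g y) (l g y) at_top"
      by (rule uniform_limit_cong[THEN iffD1, rotated 2]) (simp add: l_def d_def)
    moreover have "x0 \<in> U"
      using \<delta>(2) \<eta>(2) by (simp add: U_def)
    ultimately show ?thesis
      using \<open>open U\<close> U_chamber by blast
  qed
  then show "(\<forall>x\<in>chamber Rp. ((\<lambda>t::real. F g y t x) \<longlongrightarrow> l g y x) at_top) \<and>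
      (\<forall>x\<in>chamber Rp. \<exists>U. open U \<and> x \<in> U \<and> U \<subseteq> chamber Rp \<and>
         uniform_limit U (F g y) (l g y) at_top)"
    by (blast intro: tendsto_uniform_limitI)
qed

end
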